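(* Let $p$ be a prime and let $T$ be a complete first-order theory in a language containing a binary relation symbol $<$, such that in models of $T$ the relation $<$ is a linear order, and such that $T$ defines an infinite-dimensional vector space over the prime field $\mathbb F_p$ (i.e. there are a definable set $V$ and definable operations making $V$ into a vector space over $\mathbb F_p$, infinite-dimensional in models of $T$). Then $T$ has the independence property (IP).
   Context: A theory has IP if some formula $\phi(x,y)$ has the independence property: for every $k$ there are $b_1,\dots,b_k$ and $(d_I)_{I\subseteq\{1,\dots,k\}}$ in a model with $\phi(d_I,b_l)$ holding iff $l\in I$ (or, equivalently for this purpose, iff $l\notin I$). *)

theory Defs
  imports
    "HOL-Number_Theory.Residues"
    "Jordan_Normal_Form.Missing_VectorSpace"
begin

section \<open>First-order logic with equality\<close>

text \<open>
  Symbols come from the types \<open>'f\<close> and \<open>'r\<close>, of which a language uses a (possibly empty) subset;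
  constants are function symbols of arity 0.
\<close>

record ('f, 'r) language =
  fun_syms :: "'f set"
  rel_syms :: "'r set"
  fun_arity :: "'f \<Rightarrow> nat"
  rel_arity :: "'r \<Rightarrow> nat"

datatype 'f trm = Var nat | App 'f "'f trm list"

datatype ('f, 'r) form =
    Eq "'f trm" "'f trm"
  | Rel 'r "'f trm list"
  | Neg "('f, 'r) form"
  | Conj "('f, 'r) form" "('f, 'r) form"
  | Exi nat "('f, 'r) form"

primrec wf_trm :: "('f, 'r) language \<Rightarrow> 'f trm \<Rightarrow> bool" where
  "wf_trm L (Var i) \<longleftrightarrow> True"
| "wf_trm L (App f ts) \<longleftrightarrow>
     f \<in> fun_syms L \<and> length ts = fun_arity L f \<and> list_all (wf_trm L) ts"

primrec wf_form :: "('f, 'r) language \<Rightarrow> ('f, 'r) form \<Rightarrow> bool" where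
  "wf_form L (Eq s t) \<longleftrightarrow> wf_trm L s \<and> wf_trm L t"
| "wf_form L (Rel r ts) \<longleftrightarrow>
     r \<in> rel_syms L \<and> length ts = rel_arity L r \<and> list_all (wf_trm L) ts"
| "wf_form L (Neg \<phi>) \<longleftrightarrow> wf_form L \<phi>"
| "wf_form L (Conj \<phi> \<psi>) \<longleftrightarrow> wf_form L \<phi> \<and> wf_form L \<psi>"
| "wf_form L (Exi i \<phi>) \<longleftrightarrow> wf_form L \<phi>"

primrec vars_trm :: "'f trm \<Rightarrow> nat set" where
  "vars_trm (Var i) = {i}"
| "vars_trm (App f ts) = \<Union> (set (map vars_trm ts))"

primrec free_vars :: "('f, 'r) form \<Rightarrow> nat set" where
  "free_vars (Eq s t) = vars_trm s \<union> vars_trm t"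
| "free_vars (Rel r ts) = \<Union> (vars_trm ` set ts)"
| "free_vars (Neg \<phi>) = free_vars \<phi>"
| "free_vars (Conj \<phi> \<psi>) = free_vars \<phi> \<union> free_vars \<psi>"
| "free_vars (Exi i \<phi>) = free_vars \<phi> - {i}"

definition formula_in :: "('f, 'r) language \<Rightarrow> nat \<Rightarrow> ('f, 'r) form \<Rightarrow> bool" where
  "formula_in L n \<phi> \<longleftrightarrow> wf_form L \<phi> \<and> free_vars \<phi> \<subseteq> {..<n}"

abbreviation sentence :: "('f, 'r) language \<Rightarrow> ('f, 'r) form \<Rightarrow> bool" where
  "sentence L \<equiv> formula_in L 0"

record ('f, 'r, 'm) struct =
  univ :: "'m set"
  fun_int :: "'f \<Rightarrow> 'm list \<Rightarrow> 'm"
  rel_int :: "'r \<Rightarrow> 'm list \<Rightarrow> bool"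

definition is_struct :: "('f, 'r) language \<Rightarrow> ('f, 'r, 'm) struct \<Rightarrow> bool" where
  "is_struct L M \<longleftrightarrow>
     univ M \<noteq> {} \<and>
     (\<forall>f\<in>fun_syms L. \<forall>xs. length xs = fun_arity L f \<and> set xs \<subseteq> univ M \<longrightarrow> fun_int M f xs \<in> univ M)"

primrec eval_trm :: "('f, 'r, 'm) struct \<Rightarrow> (nat \<Rightarrow> 'm) \<Rightarrow> 'f trm \<Rightarrow> 'm" where
  "eval_trm M e (Var i) = e i"
| "eval_trm M e (App f ts) = fun_int M f (map (eval_trm M e) ts)"

primrec sat :: "('f, 'r, 'm) struct \<Rightarrow> (nat \<Rightarrow> 'm) \<Rightarrow> ('f, 'r) form \<Rightarrow> bool" where
  "sat M e (Eq s t) \<longleftrightarrow> eval_trm M e s = eval_trm M e t"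
| "sat M e (Rel r ts) \<longleftrightarrow> rel_int M r (map (eval_trm M e) ts)"
| "sat M e (Neg \<phi>) \<longleftrightarrow> \<not> sat M e \<phi>"
| "sat M e (Conj \<phi> \<psi>) \<longleftrightarrow> sat M e \<phi> \<and> sat M e \<psi>"
| "sat M e (Exi i \<phi>) \<longleftrightarrow> (\<exists>a\<in>univ M. sat M (e(i := a)) \<phi>)"

text \<open>
  Variable \<open>i\<close> is assigned the \<open>i\<close>-th entry of \<open>xs\<close>. Only meaningful if
  \<open>formula_in L (length xs) \<phi>\<close>, as the values beyond the end of the list are unspecified.
\<close>

definition holds :: "('f, 'r, 'm) struct \<Rightarrow> ('f, 'r) form \<Rightarrow> 'm list \<Rightarrow> bool" where
  "holds M \<phi> xs \<longleftrightarrow> sat M (\<lambda>i. xs ! i) \<phi>"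

section \<open>Theories\<close>

definition theory_in :: "('f, 'r) language \<Rightarrow> ('f, 'r) form set \<Rightarrow> bool" where
  "theory_in L T \<longleftrightarrow> (\<forall>\<phi>\<in>T. sentence L \<phi>)"

definition is_model :: "('f, 'r) language \<Rightarrow> ('f, 'r) form set \<Rightarrow> ('f, 'r, 'm) struct \<Rightarrow> bool" where
  "is_model L T M \<longleftrightarrow> is_struct L M \<and> (\<forall>\<phi>\<in>T. holds M \<phi> [])"

text \<open>
  HOL cannot quantify over all carrier types at once. By the Loewenheim-Skolem theorem a set of
  sentences has a model iff it has one whose universe is at most as large as the set of formulas, so
  for consistency and entailment it suffices to consider models with universe contained in the
  type \<open>('f, 'r) form\<close>; any finite or infinite cardinality up to \<open>|L| + \<aleph>\<^sub>0\<close> fits in there.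
\<close>

definition consistent :: "('f, 'r) language \<Rightarrow> ('f, 'r) form set \<Rightarrow> bool" where
  "consistent L T \<longleftrightarrow> (\<exists>M :: ('f, 'r, ('f, 'r) form) struct. is_model L T M)"

definition entails :: "('f, 'r) language \<Rightarrow> ('f, 'r) form set \<Rightarrow> ('f, 'r) form \<Rightarrow> bool" where
  "entails L T \<phi> \<longleftrightarrow>
     (\<forall>M :: ('f, 'r, ('f, 'r) form) struct. is_model L T M \<longrightarrow> holds M \<phi> [])"

definition complete_theory :: "('f, 'r) language \<Rightarrow> ('f, 'r) form set \<Rightarrow> bool" where
  "complete_theory L T \<longleftrightarrow>
     theory_in L T \<and> consistent L T \<and>
     (\<forall>\<phi>. sentence L \<phi> \<longrightarrow> entails L T \<phi> \<or> entails L T (Neg \<phi>))"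

section \<open>Definable vector spaces and the independence property\<close>

definition tuples :: "('f, 'r, 'm) struct \<Rightarrow> nat \<Rightarrow> 'm list set" where
  "tuples M n = {xs. length xs = n \<and> set xs \<subseteq> univ M}"

text \<open>Definability is with parameters, here \<open>cs\<close>.\<close>

definition definable ::
  "('f, 'r) language \<Rightarrow> ('f, 'r, 'm) struct \<Rightarrow> nat \<Rightarrow> 'm list set \<Rightarrow> bool" where
  "definable L M n X \<longleftrightarrow>
     (\<exists>\<phi> cs. set cs \<subseteq> univ M \<and> formula_in L (n + length cs) \<phi> \<and>
        X = {xs \<in> tuples M n. holds M \<phi> (xs @ cs)})"

text \<open>
  The vectors are \<open>n\<close>-tuples from \<open>M\<close>; addition and multiplication by each scalar are definable in
  the sense that their graphs are.
\<close>

definition definable_vectorspace ::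
  "('f, 'r) language \<Rightarrow> ('f, 'r, 'm) struct \<Rightarrow> nat \<Rightarrow> 'a ring \<Rightarrow> ('a, 'm list) module \<Rightarrow> bool" where
  "definable_vectorspace L M n K V \<longleftrightarrow>
     vectorspace K V \<and>
     definable L M n (carrier V) \<and>
     definable L M (3 * n) {x @ y @ (x \<oplus>\<^bsub>V\<^esub> y) | x y. x \<in> carrier V \<and> y \<in> carrier V} \<and>
     (\<forall>a\<in>carrier K. definable L M (2 * n) {x @ (a \<odot>\<^bsub>V\<^esub> x) | x. x \<in> carrier V})"

text \<open>
  Asking for one model and allowing parameters is the most inclusive reading. If the defining
  formulas have no parameters, completeness of \<open>T\<close> makes it equivalent to asking the same of every
  model, because being an infinite-dimensional vector space over a finite field is then expressed
  by a set of sentences.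
\<close>

definition defines_inf_dim_vectorspace ::
  "'m itself \<Rightarrow> ('f, 'r) language \<Rightarrow> ('f, 'r) form set \<Rightarrow> 'a ring \<Rightarrow> bool" where
  "defines_inf_dim_vectorspace _ L T K \<longleftrightarrow>
     (\<exists>(M :: ('f, 'r, 'm) struct) n V.
        is_model L T M \<and> definable_vectorspace L M n K V \<and> \<not> vectorspace.fin_dim K V)"

text \<open>
  The variables \<open>x\<close> and \<open>y\<close> of \<open>\<phi>(x, y)\<close> are tuples, of lengths \<open>m\<close> and \<open>n\<close>.
  Models are taken over the carrier type \<open>'m\<close>.
\<close>

definition has_IP :: "'m itself \<Rightarrow> ('f, 'r) language \<Rightarrow> ('f, 'r) form set \<Rightarrow> bool" where
  "has_IP _ L T \<longleftrightarrow>
     (\<exists>\<phi> m n. formula_in L (m + n) \<phi> \<and>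
        (\<forall>k::nat. \<exists>(M :: ('f, 'r, 'm) struct) (b :: nat \<Rightarrow> 'm list) (d :: nat set \<Rightarrow> 'm list).
           is_model L T M \<and>
           (\<forall>l\<in>{1..k}. b l \<in> tuples M n) \<and>
           (\<forall>I\<subseteq>{1..k}. d I \<in> tuples M m) \<and>
           (\<forall>I\<subseteq>{1..k}. \<forall>l\<in>{1..k}. holds M \<phi> (d I @ b l) \<longleftrightarrow> l \<in> I)))"

end

theory Submission
  imports Defs "HOL-Library.Ramsey"
begin

text \<open>
  Order \<open>V\<close> lexicographically as a set of tuples. The formula \<open>x + y < x + z\<close> already has the
  independence property in every infinite abelian group of bounded exponent \<open>p\<close> with a linear order,
  by Ramsey's theorem. Take distinct vectors \<open>e 0, e 1, \<dots>\<close>. For a \<open>k + 1\<close>-set \<open>S\<close> of indices with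
  consecutive elements \<open>u < v\<close> in positions \<open>t, t + 1\<close>, the sequence
  \<open>b j = \<Sum>(S - {u, v}) + e u + j (e v - e u)\<close> has period \<open>p\<close> and distinct consecutive
  entries, so some ascent \<open>b a < b (a + 1)\<close> is followed by a descent. On an infinite homogeneous set the position
  \<open>a\<close> depends only on \<open>t\<close>. Now split that set into pairs \<open>u t < v t\<close> and let \<open>d\<close> be the sum of a
  choice of one vector from each pair. Replacing the choice \<open>e (u t)\<close> by \<open>e (v t)\<close> shifts the
  corresponding sequence \<open>j \<mapsto> d + j (e (v t) - e (u t))\<close> by one, so the comparison of its \<open>a\<close>-th and
  \<open>(a + 1)\<close>-st entries reveals which of the two was chosen, for all \<open>t < k\<close> independently.
\<close>

section \<open>Ramsey argument in linearly ordered abelian groups of bounded exponent\<close>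

text \<open>Otherwise ascents propagate. One at some \<open>a < p\<close> would continue through a
  full period and put \<open>b a\<close> below \<open>b (a + p) = b a\<close>; the indices met on
  the way stay below \<open>2 * p\<close>, whence this bound. With no ascent among the first
  \<open>p\<close> steps, totality makes all of them descents and puts \<open>b p\<close> below
  \<open>b 0 = b p\<close>.\<close>

lemma cyclic_sequence_ascent_descent:
  fixes b :: "nat \<Rightarrow> 'a"
  assumes R: "strict_linear_order_on A R"
    and b: "range b \<subseteq> A" "\<And>j. b j \<noteq> b (Suc j)" "\<And>j. b (j + p) = b j"
    and p: "0 < p"
  shows "\<exists>a < 2 * p. (b a, b (Suc a)) \<in> R \<and> (b (Suc a), b (Suc (Suc a))) \<notin> R"
proof (rule ccontr)
  assume "\<not> ?thesis"
  then have step: "(b (Suc a), b (Suc (Suc a))) \<in> R" if "(b a, b (Suc a)) \<in> R" "a < 2 * p" for a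
    using that by blast
  have tr: "trans R" and irr: "irrefl R" and tot: "total_on A R"
    using R by (auto simp: strict_linear_order_on_def)
  show False
  proof (cases "\<exists>a < p. (b a, b (Suc a)) \<in> R")
    case True
    then obtain a where a: "a < p" "(b a, b (Suc a)) \<in> R" by blast
    have up: "(b (a + i), b (Suc (a + i))) \<in> R" if "i < p" for i
      using that by (induction i) (use a step in auto)
    have "(b a, b (a + i)) \<in> R" if "0 < i" "i \<le> p" for i
      using that
    proof (induction i)
      case (Suc i)
      then show ?case
        using up[of i] a by (cases "i = 0") (auto intro: transD[OF tr])
    qed simp
    from this[of p] show False
      using p irr b(3) by (auto simp: irrefl_def)
  next
    case False
    then have down: "(b (Suc i), b i) \<in> R" if "i < p" for i
      using that tot b(1,2) unfolding total_on_def by (metis range_subsetD)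
    have "(b i, b 0) \<in> R" if "0 < i" "i \<le> p" for i
      using that
    proof (induction i)
      case (Suc i)
      then show ?case
        using down[of i] by (cases "i = 0") (auto intro: transD[OF tr])
    qed simp
    from this[of p] show False
      using p irr b(3)[of 0] by (auto simp: irrefl_def)
  qed
qed

definition nth_elt :: "'a::linorder set \<Rightarrow> nat \<Rightarrow> 'a" where
  "nth_elt S q = (THE z. z \<in> S \<and> card {w \<in> S. w < z} = q)"

lemma nth_elt_eq:
  assumes "finite S" "z \<in> S" "card {w \<in> S. w < z} = q"
  shows "nth_elt S q = z"
  unfolding nth_elt_def
proof (rule the_equality)
  have less: "card {w \<in> S. w < x} < card {w \<in> S. w < y}" if "x \<in> S" "x < y" for x y
    using that assms(1) by (intro psubset_card_mono) auto
  fix y assume "y \<in> S \<and> card {w \<in> S. w < y} = q"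
  then show "y = z"
    using less[of y z] less[of z y] assms by (cases y z rule: linorder_cases) auto
qed (use assms in auto)

text \<open>A numbering of \<open>C\<close> turns the colours into numbers below a bound, as
  \<open>Ramsey\<close> expects them.\<close>

lemma Ramsey_finite_colours:
  fixes f :: "'a set \<Rightarrow> 'b"
  assumes "infinite Z" "finite C" "\<And>X. \<lbrakk>X \<subseteq> Z; finite X; card X = r\<rbrakk> \<Longrightarrow> f X \<in> C"
  obtains Y c where "Y \<subseteq> Z" "infinite Y" "\<And>X. \<lbrakk>X \<subseteq> Y; finite X; card X = r\<rbrakk> \<Longrightarrow> f X = c"
proof -
  obtain num :: "'b \<Rightarrow> nat" and s where num: "num ` C = {i. i < s}" "inj_on num C"
    using finite_imp_inj_to_nat_seg[OF assms(2)] by blast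
  have "num (f X) < s" if "X \<subseteq> Z" "finite X" "card X = r" for X
    using assms(3)[OF that] num(1) by blast
  then obtain Y t where Y: "Y \<subseteq> Z" "infinite Y"
      "\<And>X. \<lbrakk>X \<subseteq> Y; finite X; card X = r\<rbrakk> \<Longrightarrow> num (f X) = t"
    using Ramsey[OF assms(1), of r "\<lambda>X. num (f X)" s] by metis
  have "f X = the_inv_into C num t" if "X \<subseteq> Y" "finite X" "card X = r" for X
    using Y(3)[OF that] assms(3)[of X] that Y(1) num(2) the_inv_into_f_eq by fastforce
  then show thesis
    using that Y by blast
qed

text \<open>The difficulty is that \<open>y t\<close> and \<open>z t\<close> must not depend on
  \<open>I\<close>. As \<open>R\<close> may ignore the addition, this uniformity has to come from
  Ramsey's theorem.\<close>

lemma (in abelian_group) translates_shatter: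
  fixes k p :: nat
  assumes inf: "infinite (carrier G)"
    and p: "0 < p" "\<And>x. x \<in> carrier G \<Longrightarrow> [p] \<cdot> x = \<zero>"
    and R: "strict_linear_order_on (carrier G) R"
  shows "\<exists>d y z. (\<forall>I. d I \<in> carrier G) \<and> (\<forall>t. y t \<in> carrier G \<and> z t \<in> carrier G) \<and>
    (\<forall>I. \<forall>t<k. (d I \<oplus> y t, d I \<oplus> z t) \<in> R \<longleftrightarrow> t \<in> I)"
proof -
  obtain e :: "nat \<Rightarrow> 'a" where e: "inj e" "range e \<subseteq> carrier G"
    using infinite_countable_subset[OF inf] by blast
  then have e_closed [simp]: "e i \<in> carrier G" for i by blast
  \<comment> \<open>For distinct \<open>u\<close> and \<open>v\<close> in a finite \<open>S\<close>,
    the entries at \<open>j = 0\<close> and \<open>j = 1\<close> are the sums over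
    \<open>S - {v}\<close> and \<open>S - {u}\<close>.\<close>
  define cyc where "cyc S u v j = finsum G e (S - {u, v}) \<oplus> e u \<oplus> [j] \<cdot> (e v \<ominus> e u)"
    for S and u v j :: nat
  define good where "good S u v a \<longleftrightarrow> (cyc S u v a, cyc S u v (Suc a)) \<in> R \<and>
    (cyc S u v (Suc a), cyc S u v (Suc (Suc a))) \<notin> R" for S and u v a :: nat
  have cyc_closed: "cyc S u v j \<in> carrier G" for S u v j
    unfolding cyc_def by (intro add.m_closed add.nat_pow_closed finsum_closed minus_closed) auto
  have cyc_Suc: "cyc S u v (Suc j) = cyc S u v j \<oplus> (e v \<ominus> e u)" for S u v j
    unfolding cyc_def by (simp add: add.m_assoc)
  have ex_good: "\<exists>a < 2 * p. good S u v a" if "u \<noteq> v" for S and u v :: nat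
    unfolding good_def
  proof (rule cyclic_sequence_ascent_descent[OF R _ _ _ p(1)])
    show "range (cyc S u v) \<subseteq> carrier G" using cyc_closed by blast
    have "e u \<noteq> e v" using that e(1) by (auto dest: injD)
    moreover have "e v = (e v \<ominus> e u) \<oplus> e u" by (simp add: minus_eq a_assoc l_neg)
    ultimately have "e v \<ominus> e u \<noteq> \<zero>" by auto
    then show "cyc S u v j \<noteq> cyc S u v (Suc j)" for j
      unfolding cyc_Suc using cyc_closed[of S u v j]
      by (metis add.l_cancel_one' e_closed minus_closed)
    show "cyc S u v (j + p) = cyc S u v j" for j
      unfolding cyc_def using p(2)[of "e v \<ominus> e u"]
      by (simp add: add.nat_pow_mult[symmetric])
  qed
  define pos where "pos S u v = (SOME a. a < 2 * p \<and> good S u v a)" for S and u v :: nat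
  have pos: "pos S u v < 2 * p" "good S u v (pos S u v)" if "u \<noteq> v" for S u v
    using someI_ex[OF ex_good[OF that, of S]] unfolding pos_def by blast+
  \<comment> \<open>A colour records the positions for all \<open>t < k\<close> at once. The default
    0 keeps the entries below \<open>2 * p\<close> for arbitrary \<open>S\<close>; it does not arise
    for sets of \<open>k + 1\<close> elements.\<close>
  define col where "col S = map (\<lambda>t. if nth_elt S t = nth_elt S (Suc t) then 0
      else pos S (nth_elt S t) (nth_elt S (Suc t))) [0..<k]" for S
  have col: "col S \<in> {xs. set xs \<subseteq> {..<2 * p} \<and> length xs = k}" for S
    using pos(1) p(1) unfolding col_def by auto
  obtain H c where H: "infinite H"
      and c: "\<And>S. \<lbrakk>S \<subseteq> H; finite S; card S = Suc k\<rbrakk> \<Longrightarrow> col S = c"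
    using Ramsey_finite_colours[OF infinite_UNIV_nat
        finite_lists_length_eq[OF finite_lessThan, of "2 * p" k], of "Suc k" col] col
    by metis
  define h where "h = enumerate H"
  have h_less [simp]: "h i < h j \<longleftrightarrow> i < j" for i j
    unfolding h_def using H by simp
  then have h_eq [simp]: "h i = h j \<longleftrightarrow> i = j" for i j
    by (metis less_irrefl linorder_neq_iff)
  have h_in [simp]: "h i \<in> H" for i
    unfolding h_def using H by (simp add: enumerate_in_set)
  \<comment> \<open>Pair number \<open>s\<close> consists of \<open>h (2 * s)\<close> and
    \<open>h (Suc (2 * s))\<close>; \<open>w I s\<close> is the member chosen from it.\<close>
  define w where "w I s = h (if s \<in> I then 2 * s else Suc (2 * s))" for I s
  define rest where "rest I t = w I ` ({..<k} - {t})" for I t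
  \<comment> \<open>For \<open>t < k\<close> this is a set of \<open>k + 1\<close> indices: one
    choice from each other pair, and both members of pair \<open>t\<close>, which get the ranks
    \<open>t\<close> and \<open>t + 1\<close>.\<close>
  define S where "S I t = insert (h (2 * t)) (insert (h (Suc (2 * t))) (rest I t))" for I t
  define d where "d I = finsum G e (w I ` {..<k})" for I
  define r where "r t = e (h (Suc (2 * t))) \<ominus> e (h (2 * t))" for t
  \<comment> \<open>The pairs are consecutive blocks of \<open>H\<close>, so a choice from another
    pair lies on the same side of both members of pair \<open>t\<close>.\<close>
  have w_less: "w I s < h (2 * t) \<longleftrightarrow> s < t" "w I s < h (Suc (2 * t)) \<longleftrightarrow> s < t" if "s \<noteq> t" for I s t
    using that by (auto simp: w_def)
  have w_neq: "w I s \<noteq> h (2 * t)" "w I s \<noteq> h (Suc (2 * t))" if "s \<noteq> t" for I s t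
    using that by (auto simp: w_def split: if_splits)
  have inj_w: "inj (w I)" for I
    by (rule injI) (auto simp: w_def split: if_splits)
  have fin_rest [simp]: "finite (rest I t)" for I t by (simp add: rest_def)
  have notin_rest: "h (2 * t) \<notin> rest I t" "h (Suc (2 * t)) \<notin> rest I t" for I t
    using w_neq unfolding rest_def by fastforce+
  \<comment> \<open>Homogeneity of \<open>H\<close> removes the dependence on \<open>I\<close>: the
    sets \<open>S I t\<close> all have colour \<open>c\<close>.\<close>
  have pos_c: "pos (S I t) (h (2 * t)) (h (Suc (2 * t))) = c ! t" if "t < k" for I t
  proof -
    have "card (rest I t) = k - 1"
      unfolding rest_def using that inj_w by (subst card_image) (auto intro: inj_on_subset)
    then have card: "card (S I t) = Suc k"
      using notin_rest that by (simp add: S_def)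
    have "{x \<in> S I t. x < h (2 * t)} = w I ` {..<t}"
      using that w_less by (auto simp: S_def rest_def)
    then have below1: "card {x \<in> S I t. x < h (2 * t)} = t"
      using inj_w by (simp add: card_image inj_on_subset[of _ UNIV])
    have "{x \<in> S I t. x < h (Suc (2 * t))} = insert (h (2 * t)) (w I ` {..<t})"
      using that w_less by (auto simp: S_def rest_def)
    moreover have "h (2 * t) \<notin> w I ` {..<t}"
      using w_neq(1)[of _ t I] by (metis imageE lessThan_iff less_irrefl)
    ultimately have below2: "card {x \<in> S I t. x < h (Suc (2 * t))} = Suc t"
      using inj_w by (simp add: card_image inj_on_subset[of _ UNIV])
    have "nth_elt (S I t) t = h (2 * t)" "nth_elt (S I t) (Suc t) = h (Suc (2 * t))"
      using below1 below2 by (auto intro!: nth_elt_eq simp: S_def)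
    then have "col (S I t) ! t = pos (S I t) (h (2 * t)) (h (Suc (2 * t)))"
      using that by (simp add: col_def)
    moreover have "col (S I t) = c"
      by (rule c) (use card in \<open>auto simp: S_def rest_def w_def\<close>)
    ultimately show ?thesis by simp
  qed
  have d_closed: "d I \<in> carrier G" for I
    unfolding d_def by (rule finsum_closed) auto
  have r_closed: "r t \<in> carrier G" for t
    by (simp add: r_def)
  have S_diff: "S I t - {h (2 * t), h (Suc (2 * t))} = rest I t" for I t
    using notin_rest by (auto simp: S_def)
  have d_split: "d I = finsum G e (rest I t) \<oplus> e (w I t)" if "t < k" for I t
  proof -
    have "w I ` {..<k} = insert (w I t) (rest I t)"
      using that by (auto simp: rest_def)
    moreover have "w I t \<notin> rest I t"
      using notin_rest by (auto simp: w_def)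
    ultimately show ?thesis
      unfolding d_def using finsum_insert[of "rest I t" "w I t" e]
      by (simp add: Pi_def a_comm)
  qed
  \<comment> \<open>The sum \<open>d I\<close> is entry 0 of the cyclic sequence if
    \<open>t \<in> I\<close> and entry 1 otherwise, which shifts all later entries by one.\<close>
  have d_cyc: "d I \<oplus> [j] \<cdot> r t =
      cyc (S I t) (h (2 * t)) (h (Suc (2 * t))) (if t \<in> I then j else Suc j)"
    if "t < k" for I and t j :: nat
  proof (cases "t \<in> I")
    case True
    then show ?thesis
      by (simp add: d_split[OF that] cyc_def S_diff r_def w_def)
  next
    case False
    have "e (h (2 * t)) \<oplus> r t = e (h (Suc (2 * t)))"
      by (simp add: r_def minus_eq a_comm[of "e (h (Suc (2 * t)))"] r_neg2)
    then have "e (h (2 * t)) \<oplus> [Suc j] \<cdot> r t = e (h (Suc (2 * t))) \<oplus> [j] \<cdot> r t"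
      using r_closed by (metis a_assoc add.nat_pow_Suc2 add.nat_pow_closed e_closed)
    moreover have "finsum G e (rest I t) \<in> carrier G"
      by (rule finsum_closed) auto
    ultimately show ?thesis
      using False r_closed
      by (simp add: d_split[OF that] cyc_def S_diff w_def a_assoc del: add.nat_pow_Suc flip: r_def)
  qed
  \<comment> \<open>For \<open>t \<in> I\<close> the entries \<open>c ! t\<close> and
    \<open>c ! t + 1\<close> are compared, an ascent; otherwise the next two, which do not
    ascend.\<close>
  have "(d I \<oplus> [c ! t] \<cdot> r t, d I \<oplus> [Suc (c ! t)] \<cdot> r t) \<in> R \<longleftrightarrow> t \<in> I" if "t < k" for I t
  proof -
    have "good (S I t) (h (2 * t)) (h (Suc (2 * t))) (c ! t)"
      using pos(2)[of "h (2 * t)" "h (Suc (2 * t))" "S I t"] pos_c[OF that] by simp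
    then show ?thesis
      unfolding d_cyc[OF that] good_def by simp
  qed
  then show ?thesis
    by (intro exI[of _ d] exI[of _ "\<lambda>t. [c ! t] \<cdot> r t"] exI[of _ "\<lambda>t. [Suc (c ! t)] \<cdot> r t"])
      (use d_closed r_closed in \<open>auto simp del: add.nat_pow_Suc\<close>)
qed

section \<open>Assignments, blocks of quantifiers and substitution of variables\<close>

lemma eval_trm_cong:
  "(\<And>i. i \<in> vars_trm t \<Longrightarrow> e i = e' i) \<Longrightarrow> eval_trm M e t = eval_trm M e' t"
proof (induction t)
  case (App f ts)
  then have "map (eval_trm M e) ts = map (eval_trm M e') ts"
    by (intro map_cong refl) auto
  then show ?case by (simp only: eval_trm.simps)
qed simp

lemma sat_cong:
  "(\<And>i. i \<in> free_vars \<phi> \<Longrightarrow> e i = e' i) \<Longrightarrow> sat M e \<phi> \<longleftrightarrow> sat M e' \<phi>"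
proof (induction \<phi> arbitrary: e e')
  case (Eq s t)
  then show ?case using eval_trm_cong[of s e e' M] eval_trm_cong[of t e e' M] by simp
next
  case (Rel r ts)
  then have "map (eval_trm M e) ts = map (eval_trm M e') ts"
    by (intro map_cong refl eval_trm_cong) auto
  then show ?case by (simp only: sat.simps)
next
  case (Neg \<phi>)
  have "sat M e \<phi> \<longleftrightarrow> sat M e' \<phi>"
    using Neg.prems by (intro Neg.IH) simp
  then show ?case by (simp only: sat.simps)
next
  case (Conj \<phi> \<psi>)
  have "sat M e \<phi> \<longleftrightarrow> sat M e' \<phi>" "sat M e \<psi> \<longleftrightarrow> sat M e' \<psi>"
    using Conj.prems by (intro Conj.IH; simp)+
  then show ?case by (simp only: sat.simps)
next
  case (Exi i \<phi>)
  have "sat M (e(i := a)) \<phi> \<longleftrightarrow> sat M (e'(i := a)) \<phi>" for a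
    using Exi.prems by (intro Exi.IH) auto
  then show ?case by (simp only: sat.simps)
qed

abbreviation exis :: "nat list \<Rightarrow> ('f, 'r) form \<Rightarrow> ('f, 'r) form" where
  "exis is \<phi> \<equiv> foldr Exi is \<phi>"

lemma wf_exis: "wf_form L (exis is \<phi>) \<longleftrightarrow> wf_form L \<phi>"
  by (induction "is") auto

lemma free_vars_exis: "free_vars (exis is \<phi>) = free_vars \<phi> - set is"
  by (induction "is") auto

text \<open>The successive witnesses are gathered in one assignment \<open>e'\<close>. This also
  covers repeated indices, where an inner quantifier overwrites the outer value.\<close>

lemma sat_exis:
  "sat M e (exis is \<phi>) \<longleftrightarrow>
     (\<exists>e'. (\<forall>i. i \<notin> set is \<longrightarrow> e' i = e i) \<and> (\<forall>i\<in>set is. e' i \<in> univ M) \<and> sat M e' \<phi>)"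
proof (induction "is" arbitrary: e)
  case Nil
  have "e' = e" if "\<forall>i. e' i = e i" for e' using that by auto
  then show ?case by auto
next
  case (Cons k "is")
  show ?case
  proof
    assume "sat M e (exis (k # is) \<phi>)"
    then obtain a e' where "a \<in> univ M" "\<forall>i. i \<notin> set is \<longrightarrow> e' i = (e(k := a)) i"
        "\<forall>i\<in>set is. e' i \<in> univ M" "sat M e' \<phi>"
      by (auto simp: Cons.IH)
    then show "\<exists>e'. (\<forall>i. i \<notin> set (k # is) \<longrightarrow> e' i = e i) \<and>
        (\<forall>i\<in>set (k # is). e' i \<in> univ M) \<and> sat M e' \<phi>"
      by (intro exI[of _ e']) (auto split: if_splits)
  next
    assume "\<exists>e'. (\<forall>i. i \<notin> set (k # is) \<longrightarrow> e' i = e i) \<and>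
        (\<forall>i\<in>set (k # is). e' i \<in> univ M) \<and> sat M e' \<phi>"
    then obtain e' where e': "\<forall>i. i \<notin> set (k # is) \<longrightarrow> e' i = e i"
        "\<forall>i\<in>set (k # is). e' i \<in> univ M" "sat M e' \<phi>" by blast
    then have "sat M (e(k := e' k)) (exis is \<phi>)"
      unfolding Cons.IH by (intro exI[of _ e']) auto
    then show "sat M e (exis (k # is) \<phi>)"
      using e'(2) by auto
  qed
qed

text \<open>
  Substituting \<open>Var (\<sigma> i)\<close> for \<open>Var i\<close> by quantifying over the old variables avoids renaming
  bound variables; it requires the new variables to lie beyond the old ones.
\<close>

definition plug :: "(nat \<Rightarrow> nat) \<Rightarrow> nat \<Rightarrow> ('f, 'r) form \<Rightarrow> ('f, 'r) form" where
  "plug \<sigma> N \<phi> = exis [0..<N] (foldr (\<lambda>i. Conj (Eq (Var i) (Var (\<sigma> i)))) [0..<N] \<phi>)"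

lemma wf_plug: "wf_form L (plug \<sigma> N \<phi>) \<longleftrightarrow> wf_form L \<phi>"
proof -
  have "wf_form L (foldr (\<lambda>i. Conj (Eq (Var i) (Var (\<sigma> i)))) xs \<phi>) \<longleftrightarrow> wf_form L \<phi>" for xs
    by (induction xs) auto
  then show ?thesis by (simp add: plug_def wf_exis)
qed

lemma free_vars_plug:
  assumes "free_vars \<phi> \<subseteq> {..<N}"
  shows "free_vars (plug \<sigma> N \<phi>) \<subseteq> \<sigma> ` {..<N}"
proof -
  have "free_vars (foldr (\<lambda>i. Conj (Eq (Var i) (Var (\<sigma> i)))) xs \<phi>) =
      set xs \<union> \<sigma> ` set xs \<union> free_vars \<phi>" for xs
    by (induction xs) auto
  then show ?thesis using assms by (auto simp: plug_def free_vars_exis)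
qed

text \<open>The bound \<open>N \<le> \<sigma> i\<close> keeps the targets from being captured by the
  quantifiers over the variables below \<open>N\<close>. The values \<open>e (\<sigma> i)\<close>
  are the only possible witnesses for these quantifiers, so they must lie in the universe.\<close>

lemma sat_plug:
  assumes "free_vars \<phi> \<subseteq> {..<N}" "\<And>i. i < N \<Longrightarrow> N \<le> \<sigma> i \<and> e (\<sigma> i) \<in> univ M"
  shows "sat M e (plug \<sigma> N \<phi>) \<longleftrightarrow> sat M (e \<circ> \<sigma>) \<phi>"
proof -
  have eqs: "sat M e' (foldr (\<lambda>i. Conj (Eq (Var i) (Var (\<sigma> i)))) xs \<phi>) \<longleftrightarrow>
      (\<forall>i\<in>set xs. e' i = e' (\<sigma> i)) \<and> sat M e' \<phi>" for e' xs
    by (induction xs) auto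
  show ?thesis
  proof
    assume "sat M e (plug \<sigma> N \<phi>)"
    then obtain e' where e': "\<forall>i. i \<notin> set [0..<N] \<longrightarrow> e' i = e i"
        "\<forall>i\<in>set [0..<N]. e' i = e' (\<sigma> i)" "sat M e' \<phi>"
      unfolding plug_def sat_exis eqs by blast
    have "e' i = (e \<circ> \<sigma>) i" if "i < N" for i
      using e'(1,2) assms(2)[OF that] that by simp
    then have "sat M e' \<phi> \<longleftrightarrow> sat M (e \<circ> \<sigma>) \<phi>"
      using assms(1) by (intro sat_cong) blast
    then show "sat M (e \<circ> \<sigma>) \<phi>" using e'(3) by blast
  next
    assume *: "sat M (e \<circ> \<sigma>) \<phi>"
    let ?e = "\<lambda>i. if i < N then e (\<sigma> i) else e i"
    have "sat M ?e \<phi> \<longleftrightarrow> sat M (e \<circ> \<sigma>) \<phi>"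
      using assms(1) by (intro sat_cong) auto
    moreover have "?e i = ?e (\<sigma> i)" if "i < N" for i
      using assms(2)[OF that] that by auto
    ultimately show "sat M e (plug \<sigma> N \<phi>)"
      unfolding plug_def sat_exis eqs using * assms(2) by (intro exI[of _ ?e] conjI) simp_all
  qed
qed

section \<open>The lexicographic order and its definability\<close>

text \<open>The base case is a closed formula so that no variable beyond the two blocks occurs.\<close>

primrec lex_form :: "'r \<Rightarrow> nat \<Rightarrow> nat \<Rightarrow> nat \<Rightarrow> ('f, 'r) form" where
  "lex_form lt a b 0 = Exi 0 (Neg (Eq (Var 0) (Var 0)))"
| "lex_form lt a b (Suc n) = Neg (Conj (Neg (Rel lt [Var a, Var b]))
     (Neg (Conj (Eq (Var a) (Var b)) (lex_form lt (Suc a) (Suc b) n))))"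

lemma wf_lex_form:
  "lt \<in> rel_syms L \<Longrightarrow> rel_arity L lt = 2 \<Longrightarrow> wf_form L (lex_form lt a b n)"
  by (induction n arbitrary: a b) auto

lemma free_vars_lex_form: "free_vars (lex_form lt a b n) \<subseteq> {a..<a + n} \<union> {b..<b + n}"
proof (induction n arbitrary: a b)
  case (Suc n)
  show ?case using Suc.IH[of "Suc a" "Suc b"] by fastforce
qed simp

lemma sat_lex_form:
  assumes "\<forall>i<n. e (a + i) \<in> univ M \<and> e (b + i) \<in> univ M"
  shows "sat M e (lex_form lt a b n) \<longleftrightarrow>
    (map e [a..<a + n], map e [b..<b + n])
      \<in> lexord {(x, y). x \<in> univ M \<and> y \<in> univ M \<and> rel_int M lt [x, y]}"
  using assms
proof (induction n arbitrary: a b)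
  case (Suc n)
  have "\<forall>i<n. e (Suc a + i) \<in> univ M \<and> e (Suc b + i) \<in> univ M"
    using Suc.prems by (metis Suc_less_eq add_Suc add_Suc_right)
  moreover have "e a \<in> univ M" "e b \<in> univ M"
    using Suc.prems by (metis add.right_neutral zero_less_Suc)+
  moreover have "[c..<c + Suc n] = c # [Suc c..<Suc c + n]" for c
    by (simp add: upt_conv_Cons del: upt_Suc)
  ultimately show ?case
    using Suc.IH[of "Suc a" "Suc b"] by (simp del: upt_Suc)
qed simp

text \<open>Carries the order from elements of the model to vectors, which are tuples. Two distinct
  tuples are compared at the first entry where they differ.\<close>

lemma strict_linear_order_on_lexord:
  assumes "strict_linear_order_on A r"
    and X: "\<And>xs. xs \<in> X \<Longrightarrow> length xs = n \<and> set xs \<subseteq> A"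
  shows "strict_linear_order_on X (lexord r)"
proof -
  have r: "trans r" "irrefl r" "total_on A r"
    using assms by (auto simp: strict_linear_order_on_def)
  have "(xs, ys) \<in> lexord r \<or> (ys, xs) \<in> lexord r"
    if "length xs = length ys" "set xs \<subseteq> A" "set ys \<subseteq> A" "xs \<noteq> ys" for xs ys
    using that
  proof (induction xs ys rule: list_induct2)
    case (Cons x xs y ys)
    then show ?case using r(3) by (auto simp: total_on_def)
  qed simp
  then have "total_on X (lexord r)"
    using X unfolding total_on_def by metis
  then show ?thesis
    using r lexord_transI[OF r(1)] lexord_irreflexive[of r]
    by (auto simp: strict_linear_order_on_def irrefl_def)
qed

text \<open>The formula says that there are \<open>u\<close> and \<open>v\<close> with
  \<open>\<alpha>(x, y, u)\<close>, \<open>\<alpha>(x, z, v)\<close> and \<open>u\<close>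
  lexicographically below \<open>v\<close>. Since \<open>plug\<close> binds the variables below
  \<open>N\<close>, the arguments start only at \<open>N\<close>, behind the dummy block
  \<open>pad\<close>; together \<open>x\<close>, \<open>y\<close>, \<open>z\<close>,
  \<open>cs\<close> again have length \<open>N\<close>.\<close>

lemma lex_translates_definable:
  fixes M :: "('f, 'r, 'm) struct" and L :: "('f, 'r) language"
  assumes lt: "lt \<in> rel_syms L" "rel_arity L lt = 2"
    and cs: "set cs \<subseteq> univ M"
    and \<alpha>: "formula_in L (3 * n + length cs) \<alpha>"
    and X: "X \<subseteq> tuples M n" "\<And>x y. \<lbrakk>x \<in> X; y \<in> X\<rbrakk> \<Longrightarrow> f x y \<in> X"
    and graph: "\<And>x y w. \<lbrakk>x \<in> X; y \<in> X; w \<in> tuples M n\<rbrakk> \<Longrightarrow>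
      holds M \<alpha> (x @ y @ w @ cs) \<longleftrightarrow> w = f x y"
  defines "N \<equiv> 3 * n + length cs"
  obtains \<phi> where "formula_in L (2 * N) \<phi>"
    "\<And>pad x y z. \<lbrakk>pad \<in> tuples M N; x \<in> X; y \<in> X; z \<in> X\<rbrakk> \<Longrightarrow>
       holds M \<phi> (pad @ x @ y @ z @ cs) \<longleftrightarrow>
       (f x y, f x z) \<in> lexord {(x, y). x \<in> univ M \<and> y \<in> univ M \<and> rel_int M lt [x, y]}"
proof -
  let ?r = "{(x, y). x \<in> univ M \<and> y \<in> univ M \<and> rel_int M lt [x, y]}"
  \<comment> \<open>The values \<open>f x y\<close> and \<open>f x z\<close> are the variables \<open>2 * N, \<dots>\<close> and \<open>2 * N + n, \<dots>\<close>, behind all free ones.\<close>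
  define \<sigma> where "\<sigma> i = (if 2 * n \<le> i \<and> i < 3 * n then 2 * N + (i - 2 * n) else N + i)" for i
  \<comment> \<open>Where \<open>\<sigma>\<close> makes \<open>\<alpha>\<close> read
    \<open>x\<close>, \<open>y\<close>, \<open>f x y\<close>, \<open>cs\<close>, the map
    \<open>\<tau>\<close> makes it read \<open>x\<close>, \<open>z\<close>, \<open>f x z\<close>,
    \<open>cs\<close>.\<close>
  define \<tau> where "\<tau> i = (if 2 * n \<le> i \<and> i < 3 * n then 2 * N + (i - n)
    else if n \<le> i \<and> i < 2 * n then N + n + i else N + i)" for i
  define \<psi> where "\<psi> =
    Conj (plug \<sigma> N \<alpha>) (Conj (plug \<tau> N \<alpha>) (lex_form lt (2 * N) (2 * N + n) n))"
  define \<phi> where "\<phi> = exis [2 * N..<2 * N + 2 * n] \<psi>"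
  have fv: "free_vars \<alpha> \<subseteq> {..<N}" and wf: "wf_form L \<alpha>"
    using \<alpha> by (auto simp: formula_in_def N_def)
  have range: "\<sigma> ` {..<N} \<subseteq> {..<2 * N + 2 * n}" "\<tau> ` {..<N} \<subseteq> {..<2 * N + 2 * n}"
    by (auto simp: \<sigma>_def \<tau>_def N_def)
  have "free_vars (lex_form lt (2 * N) (2 * N + n) n) \<subseteq> {..<2 * N + 2 * n}"
    by (rule order_trans[OF free_vars_lex_form]) auto
  then have "free_vars \<psi> \<subseteq> {..<2 * N + 2 * n}"
    using order_trans[OF free_vars_plug[OF fv] range(1)] order_trans[OF free_vars_plug[OF fv] range(2)]
    by (simp add: \<psi>_def)
  then have "free_vars \<phi> \<subseteq> {..<2 * N}"
    unfolding \<phi>_def free_vars_exis by (auto simp: subset_iff not_less)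
  then have "formula_in L (2 * N) \<phi>"
    using wf wf_lex_form[OF lt] by (simp add: formula_in_def \<phi>_def \<psi>_def wf_exis wf_plug)
  moreover have "holds M \<phi> (pad @ x @ y @ z @ cs) \<longleftrightarrow> (f x y, f x z) \<in> lexord ?r"
    if pad: "pad \<in> tuples M N" and xyz: "x \<in> X" "y \<in> X" "z \<in> X" for pad x y z
  proof -
    let ?xs = "pad @ x @ y @ z @ cs"
    have len: "length pad = N" "length x = n" "length y = n" "length z = n"
      and sets: "set x \<subseteq> univ M" "set y \<subseteq> univ M" "set z \<subseteq> univ M" "set pad \<subseteq> univ M"
      using pad xyz X(1) by (auto simp: tuples_def)
    then have len_xs: "length ?xs = 2 * N" by (simp add: N_def)
    have xs_univ: "?xs ! i \<in> univ M" if "i < 2 * N" for i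
    proof -
      have "?xs ! i \<in> set ?xs" using that len_xs by (intro nth_mem) simp
      then show ?thesis using sets cs by auto
    qed
    \<comment> \<open>Here \<open>e\<close> agrees with the given tuple below \<open>2 * N\<close>,
      while its two additional blocks are arbitrary elements of the universe.\<close>
    have body: "sat M e \<psi> \<longleftrightarrow>
        map e [2 * N..<2 * N + n] = f x y \<and> map e [2 * N + n..<2 * N + 2 * n] = f x z \<and>
          (f x y, f x z) \<in> lexord ?r"
      if e: "\<And>i. i < 2 * N \<Longrightarrow> e i = ?xs ! i" "\<And>i. 2 * N \<le> i \<Longrightarrow> i < 2 * N + 2 * n \<Longrightarrow> e i \<in> univ M"
      for e
    proof -
      let ?u = "map e [2 * N..<2 * N + n]" and ?v = "map e [2 * N + n..<2 * N + 2 * n]"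
      have e_univ: "e i \<in> univ M" if "i < 2 * N + 2 * n" for i
        using that e xs_univ by (cases "i < 2 * N") auto
      have "sat M e (plug \<sigma> N \<alpha>) \<longleftrightarrow> sat M (e \<circ> \<sigma>) \<alpha>"
        by (rule sat_plug[OF fv]) (auto simp: \<sigma>_def N_def intro!: e_univ)
      also have "\<dots> \<longleftrightarrow> holds M \<alpha> (x @ y @ ?u @ cs)"
        unfolding holds_def
      proof (rule sat_cong)
        fix i assume "i \<in> free_vars \<alpha>"
        then have "i < N" using fv by blast
        then show "(e \<circ> \<sigma>) i = (x @ y @ ?u @ cs) ! i"
          by (auto simp: \<sigma>_def e(1) nth_append len N_def)
      qed
      also have "\<dots> \<longleftrightarrow> ?u = f x y"
        by (rule graph) (use xyz e_univ in \<open>auto simp: tuples_def\<close>)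
      finally have 1: "sat M e (plug \<sigma> N \<alpha>) \<longleftrightarrow> ?u = f x y" .
      have "sat M e (plug \<tau> N \<alpha>) \<longleftrightarrow> sat M (e \<circ> \<tau>) \<alpha>"
        by (rule sat_plug[OF fv]) (auto simp: \<tau>_def N_def intro!: e_univ)
      also have "\<dots> \<longleftrightarrow> holds M \<alpha> (x @ z @ ?v @ cs)"
        unfolding holds_def
      proof (rule sat_cong)
        fix i assume "i \<in> free_vars \<alpha>"
        then have "i < N" using fv by blast
        then show "(e \<circ> \<tau>) i = (x @ z @ ?v @ cs) ! i"
          by (auto simp: \<tau>_def e(1) nth_append len N_def)
      qed
      also have "\<dots> \<longleftrightarrow> ?v = f x z"
        by (rule graph) (use xyz e_univ in \<open>auto simp: tuples_def\<close>)
      finally have 2: "sat M e (plug \<tau> N \<alpha>) \<longleftrightarrow> ?v = f x z" .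
      have 3: "sat M e (lex_form lt (2 * N) (2 * N + n) n) \<longleftrightarrow> (?u, ?v) \<in> lexord ?r"
        by (subst sat_lex_form) (auto intro!: e_univ simp: mult_2 add.assoc)
      show ?thesis using 1 2 3 by (auto simp: \<psi>_def)
    qed
    have sum: "length (f x y) = n" "length (f x z) = n"
        "set (f x y) \<subseteq> univ M" "set (f x z) \<subseteq> univ M"
      using xyz X by (auto simp: tuples_def)
    show ?thesis
    proof
      assume "holds M \<phi> ?xs"
      then obtain e where "\<forall>i. i \<notin> set [2 * N..<2 * N + 2 * n] \<longrightarrow> e i = ?xs ! i"
          "\<forall>i\<in>set [2 * N..<2 * N + 2 * n]. e i \<in> univ M" "sat M e \<psi>"
        unfolding holds_def \<phi>_def sat_exis by blast
      then show "(f x y, f x z) \<in> lexord ?r"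
        using body[of e] by simp
    next
      assume lex: "(f x y, f x z) \<in> lexord ?r"
      \<comment> \<open>The witnesses are the actual values \<open>f x y\<close> and
        \<open>f x z\<close>, tuples over the universe because \<open>X\<close> is closed under
        \<open>f\<close>.\<close>
      define e where "e i = (if 2 * N \<le> i \<and> i < 2 * N + 2 * n
        then (f x y @ f x z) ! (i - 2 * N) else ?xs ! i)" for i
      have e_univ: "e i \<in> univ M" if "2 * N \<le> i" "i < 2 * N + 2 * n" for i
      proof -
        have "(f x y @ f x z) ! (i - 2 * N) \<in> set (f x y @ f x z)"
          using that sum by (intro nth_mem) simp
        then show ?thesis using that sum by (auto simp: e_def)
      qed
      have "map e [2 * N..<2 * N + n] = f x y" "map e [2 * N + n..<2 * N + 2 * n] = f x z"
        using sum by (auto intro!: nth_equalityI simp: e_def nth_append)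
      then have "sat M e \<psi>"
        using lex e_univ by (subst body) (auto simp: e_def)
      then show "holds M \<phi> ?xs"
        unfolding holds_def \<phi>_def sat_exis
        by (intro exI[of _ e]) (use e_univ in \<open>auto simp: e_def\<close>)
    qed
  qed
  ultimately show thesis using that by blast
qed

section \<open>Vector spaces over the prime field and the independence property\<close>

text \<open>A finite carrier would be a finite spanning set.\<close>

lemma (in vectorspace) infinite_carrier_if_not_fin_dim:
  assumes "\<not> fin_dim"
  shows "infinite (carrier V)"
proof
  assume "finite (carrier V)"
  moreover have "span (carrier V) = carrier V"
    using in_own_span[of "carrier V"] span_is_subset2[of "carrier V"] by blast
  ultimately show False
    using assms unfolding fin_dim_def by blast
qed

text \<open>The \<open>j\<close>-fold sum of \<open>x\<close> is the scalar multiple by the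
  representative \<open>int j mod int p\<close>, which is 0 for \<open>j = p\<close>.\<close>

lemma vectorspace_residue_ring_exponent:
  assumes p: "prime p" and V: "vectorspace (residue_ring (int p)) V" and x: "x \<in> carrier V"
  shows "[p] \<cdot>\<^bsub>V\<^esub> x = \<zero>\<^bsub>V\<^esub>"
proof -
  interpret V: vectorspace "residue_ring (int p)" V by (rule V)
  have carrier: "int j mod int p \<in> carrier (residue_ring (int p))" for j
    using prime_gt_0_nat[OF p] by (simp add: residue_ring_def)
  have p1: "1 mod int p = 1"
    using prime_gt_1_nat[OF p] by simp
  have zero: "0 \<odot>\<^bsub>V\<^esub> x = \<zero>\<^bsub>V\<^esub>"
    using V.lmult_0[OF x] by (simp add: residue_ring_def)
  have one: "1 \<odot>\<^bsub>V\<^esub> x = x"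
    using V.smult_one[OF x] by (simp add: residue_ring_def)
  have "[j] \<cdot>\<^bsub>V\<^esub> x = (int j mod int p) \<odot>\<^bsub>V\<^esub> x" for j :: nat
  proof (induction j)
    case 0
    then show ?case by (simp add: zero)
  next
    case (Suc j)
    have "int (Suc j) mod int p = (int j mod int p) \<oplus>\<^bsub>residue_ring (int p)\<^esub> (int 1 mod int p)"
      by (simp add: residue_ring_def mod_simps add.commute)
    then have "(int (Suc j) mod int p) \<odot>\<^bsub>V\<^esub> x =
        (int j mod int p) \<odot>\<^bsub>V\<^esub> x \<oplus>\<^bsub>V\<^esub> (int 1 mod int p) \<odot>\<^bsub>V\<^esub> x"
      using V.smult_l_distr[OF carrier carrier x] by (simp only:)
    then show ?case
      using Suc p1 one by simp
  qed
  from this[of p] show ?thesis using zero by simp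
qed

theorem theorem2p1:
  fixes p :: nat
    and L :: "('f, 'r) language"
    and T :: "('f, 'r) form set"
    and lt :: 'r
  assumes "prime p"
    and "complete_theory L T"
    and "lt \<in> rel_syms L" and "rel_arity L lt = 2"
    and "\<And>M :: ('f, 'r, 'm) struct. is_model L T M \<Longrightarrow>
           strict_linear_order_on (univ M)
             {(a, b). a \<in> univ M \<and> b \<in> univ M \<and> rel_int M lt [a, b]}"
    and "defines_inf_dim_vectorspace TYPE('m) L T (residue_ring (int p))"
  shows "has_IP TYPE('m) L T"
proof -
  obtain M :: "('f, 'r, 'm) struct" and n V
    where M: "is_model L T M" and V: "definable_vectorspace L M n (residue_ring (int p)) V"
      and inf_dim: "\<not> vectorspace.fin_dim (residue_ring (int p)) V"
    using assms(6) unfolding defines_inf_dim_vectorspace_def by blast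
  let ?R = "lexord {(a, b). a \<in> univ M \<and> b \<in> univ M \<and> rel_int M lt [a, b]}"
  have vs: "vectorspace (residue_ring (int p)) V"
    using V by (simp add: definable_vectorspace_def)
  interpret V: vectorspace "residue_ring (int p)" V by (rule vs)
  have carrier: "carrier V \<subseteq> tuples M n"
    using V by (auto simp: definable_vectorspace_def definable_def)
  then have len: "length x = n \<and> set x \<subseteq> univ M" if "x \<in> carrier V" for x
    using that by (auto simp: tuples_def)
  obtain \<alpha> cs where cs: "set cs \<subseteq> univ M" and \<alpha>: "formula_in L (3 * n + length cs) \<alpha>"
    and graph: "{x @ y @ (x \<oplus>\<^bsub>V\<^esub> y) | x y. x \<in> carrier V \<and> y \<in> carrier V} =
      {xs \<in> tuples M (3 * n). holds M \<alpha> (xs @ cs)}"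
    using V unfolding definable_vectorspace_def definable_def by metis
  have holds_\<alpha>: "holds M \<alpha> (x @ y @ w @ cs) \<longleftrightarrow> w = x \<oplus>\<^bsub>V\<^esub> y"
    if "x \<in> carrier V" "y \<in> carrier V" "w \<in> tuples M n" for x y w
  proof -
    have "x @ y @ w \<in> tuples M (3 * n)"
      using that len by (auto simp: tuples_def)
    then have "holds M \<alpha> (x @ y @ w @ cs) \<longleftrightarrow>
        x @ y @ w \<in> {x @ y @ (x \<oplus>\<^bsub>V\<^esub> y) | x y. x \<in> carrier V \<and> y \<in> carrier V}"
      unfolding graph by simp
    \<comment> \<open>All blocks have length \<open>n\<close>, so the concatenation splits in only
      one way.\<close>
    also have "\<dots> \<longleftrightarrow> w = x \<oplus>\<^bsub>V\<^esub> y"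
      using that len by (auto simp: append_eq_append_conv)
    finally show ?thesis .
  qed
  define N where "N = 3 * n + length cs"
  obtain \<phi> where \<phi>: "formula_in L (2 * N) \<phi>"
    "\<And>pad x y z. \<lbrakk>pad \<in> tuples M N; x \<in> carrier V; y \<in> carrier V; z \<in> carrier V\<rbrakk> \<Longrightarrow>
       holds M \<phi> (pad @ x @ y @ z @ cs) \<longleftrightarrow> (x \<oplus>\<^bsub>V\<^esub> y, x \<oplus>\<^bsub>V\<^esub> z) \<in> ?R"
    by (rule lex_translates_definable[OF assms(3,4) cs \<alpha> carrier, folded N_def])
      (rule V.a_closed holds_\<alpha> that; assumption)+
  have lin: "strict_linear_order_on (carrier V) ?R"
    by (rule strict_linear_order_on_lexord[OF assms(5)[OF M] len])
  obtain c where c: "c \<in> univ M"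
    using M by (auto simp: is_model_def is_struct_def)
  \<comment> \<open>Junk entries making room for the variables that \<open>plug\<close> quantifies over.\<close>
  define pad where "pad = replicate N c"
  have pad: "pad \<in> tuples M N"
    using c by (auto simp: pad_def tuples_def)
  have "\<exists>b d. (\<forall>l\<in>{1..k}. b l \<in> tuples M (2 * n + length cs)) \<and>
      (\<forall>I\<subseteq>{1..k}. d I \<in> tuples M (N + n)) \<and>
      (\<forall>I\<subseteq>{1..k}. \<forall>l\<in>{1..k}. holds M \<phi> (d I @ b l) \<longleftrightarrow> l \<in> I)" for k :: nat
  proof -
    obtain d y z where d: "\<And>I. d I \<in> carrier V"
      and yz: "\<And>t. y t \<in> carrier V" "\<And>t. z t \<in> carrier V"
      and shatter: "\<And>I t. t < k \<Longrightarrow> (d I \<oplus>\<^bsub>V\<^esub> y t, d I \<oplus>\<^bsub>V\<^esub> z t) \<in> ?R \<longleftrightarrow> t \<in> I"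
      using V.translates_shatter[OF V.infinite_carrier_if_not_fin_dim[OF inf_dim]
          prime_gt_0_nat[OF assms(1)] vectorspace_residue_ring_exponent[OF assms(1) vs] lin, of k]
      by blast
    \<comment> \<open>The parameters \<open>cs\<close> become part of every \<open>b l\<close>, and
      the dummy entries part of every \<open>d I\<close>, so \<open>\<phi>\<close> itself has no
      parameters. The shift by one passes from \<open>t < k\<close> to
      \<open>l \<in> {1..k}\<close>.\<close>
    let ?b = "\<lambda>l. y (l - 1) @ z (l - 1) @ cs" and ?d = "\<lambda>I. pad @ d {t. Suc t \<in> I}"
    have "?b l \<in> tuples M (2 * n + length cs)" for l
      using len[OF yz(1)] len[OF yz(2)] cs by (simp add: tuples_def)
    moreover have "?d I \<in> tuples M (N + n)" for I
      using len[OF d] pad by (simp add: tuples_def)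
    moreover have "holds M \<phi> (?d I @ ?b l) \<longleftrightarrow> l \<in> I" if l: "l \<in> {1..k}" for I l
    proof -
      obtain t where "l = Suc t" "t < k"
        using l by (cases l) auto
      then show ?thesis
        using \<phi>(2)[OF pad d yz, of "{t. Suc t \<in> I}" t t] shatter[of t "{t. Suc t \<in> I}"]
        by simp
    qed
    ultimately show ?thesis
      by (intro exI[of _ ?b] exI[of _ ?d]) blast
  qed
  moreover have "2 * N = (N + n) + (2 * n + length cs)"
    by (simp add: N_def)
  ultimately show ?thesis
    unfolding has_IP_def using M \<phi>(1) by metis
qed

end
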